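(* Let $\mu$ be a positive rational number. Then the collection $\{\mathcal{M}_\mu^i : i=1,2,\dots\}$ with the order $\sqsubset$ is a lattice with $$\sup(\mathcal{M}_\mu^\alpha,\mathcal{M}_\mu^\beta)=\mathcal{M}_\mu^{\alpha\vee\beta},\qquad \inf(\mathcal{M}_\mu^\alpha,\mathcal{M}_\mu^\beta)=\mathcal{M}_\mu^{\alpha\wedge\beta}$$ for all positive integers $\alpha,\beta$.
   Context: Matrices are over a field $\mathbb{F}$ of characteristic $0$. Write $\mu=\mu_y/\mu_x$ with $\mu_y,\mu_x$ coprime positive integers, and $\mathcal{M}_\mu^i:=\mathcal{M}_{i\mu_y\times i\mu_x}$, the vector space of $i\mu_y\times i\mu_x$ matrices. When $\alpha\mid\beta$ and $k=\beta/\alpha$, the embedding $A\mapsto A\otimes I_k$ (Kronecker product) of $\mathcal{M}_\mu^\alpha$ into $\mathcal{M}_\mu^\beta$ allows $\mathcal{M}_\mu^\alpha$ to be regarded as a subspace of $\mathcal{M}_\mu^\beta$; this space-subspace relation is the order $\mathcal{M}_\mu^\alpha\sqsubset\mathcal{M}_\mu^\beta$ (i.e. $\mathcal{M}_\mu^\alpha\sqsubset\mathcal{M}_\mu^\beta$ iff $\alpha\mid\beta$). Here $\alpha\vee\beta=\mathrm{lcm}(\alpha,\beta)$ and $\alpha\wedge\beta=\gcd(\alpha,\beta)$. A lattice is a poset in which every pair of elements has a supremum and an infimum. *)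

theory Defs
  imports "HOL-Algebra.Lattice" "Jordan_Normal_Form.VS_Connect"
begin

definition kronecker :: "'a::times mat \<Rightarrow> 'a mat \<Rightarrow> 'a mat" where
  "kronecker A B = mat (dim_row A * dim_row B) (dim_col A * dim_col B)
     (\<lambda>(i, j). A $$ (i div dim_row B, j div dim_col B) * B $$ (i mod dim_row B, j mod dim_col B))"

definition ratio_num :: "rat \<Rightarrow> nat" where
  "ratio_num \<mu> = nat (fst (quotient_of \<mu>))"

definition ratio_den :: "rat \<Rightarrow> nat" where
  "ratio_den \<mu> = nat (snd (quotient_of \<mu>))"

lemma ratio_num_den:
  assumes "0 < \<mu>"
  shows "0 < ratio_num \<mu>" "0 < ratio_den \<mu>" "coprime (ratio_num \<mu>) (ratio_den \<mu>)"
    and "\<mu> = of_nat (ratio_num \<mu>) / of_nat (ratio_den \<mu>)"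
proof -
  obtain a b where q: "quotient_of \<mu> = (a, b)" by fastforce
  have b: "b > 0" and c: "coprime a b" and e: "\<mu> = of_int a / of_int b"
    using q quotient_of_denom_pos quotient_of_coprime quotient_of_div by auto
  have a: "a > 0" using assms b e by (simp add: zero_less_divide_iff)
  show "0 < ratio_num \<mu>" "0 < ratio_den \<mu>"
    using a b q by (auto simp: ratio_num_def ratio_den_def)
  show "coprime (ratio_num \<mu>) (ratio_den \<mu>)"
    using a b c q by (simp add: ratio_num_def ratio_den_def flip: coprime_int_iff)
  show "\<mu> = of_nat (ratio_num \<mu>) / of_nat (ratio_den \<mu>)"
    using a b e q by (simp add: ratio_num_def ratio_den_def)
qed

definition matrix_space :: "'a::field_char_0 itself \<Rightarrow> rat \<Rightarrow> nat \<Rightarrow> ('a, 'a mat) module" where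
  "matrix_space ty \<mu> i = module_mat ty (i * ratio_num \<mu>) (i * ratio_den \<mu>)"

text \<open>The space \<open>V\<close> counts as a subspace of \<open>W\<close> when, for some \<open>k > 0\<close>, the map taking \<open>A\<close> to
  its Kronecker product with the \<open>k \<times> k\<close> identity embeds \<open>V\<close> linearly into \<open>W\<close>.
  For \<open>V\<close> of index \<open>\<alpha>\<close> and \<open>W\<close> of index \<open>\<beta>\<close> the only possible \<open>k\<close> is \<open>\<beta> / \<alpha>\<close>; see
  \<open>kron_subspace_iff_dvd\<close>.\<close>

definition kron_subspace ::
  "('a::field, 'a mat) module \<Rightarrow> ('a, 'a mat) module \<Rightarrow> bool" where
  "kron_subspace V W \<longleftrightarrow> (\<exists>k>0. linear_map class_ring V W (\<lambda>A. kronecker A (1\<^sub>m k)) \<and>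
     inj_on (\<lambda>A. kronecker A (1\<^sub>m k)) (carrier V))"

definition matrix_space_order ::
  "'a::field_char_0 itself \<Rightarrow> rat \<Rightarrow> ('a, 'a mat) module gorder" where
  "matrix_space_order ty \<mu> =
     \<lparr> carrier = {matrix_space ty \<mu> i | i. i > 0}, eq = (=), le = kron_subspace \<rparr>"

lemma vectorspace_module_mat:
  "vectorspace class_ring (module_mat TYPE('a::field) nr nc)"
proof -
  interpret abelian_group "module_mat TYPE('a) nr nc" by (rule abelian_group_mat)
  show ?thesis
    by unfold_locales (auto simp: module_mat_simps add_smult_distrib_left_mat
        add_smult_distrib_right_mat mult.assoc intro!: eq_matI)
qed

lemma linear_map_kronecker_one:
  "linear_map class_ring (module_mat TYPE('a::field) nr nc) (module_mat TYPE('a) (nr * k) (nc * k))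
     (\<lambda>A. kronecker A (1\<^sub>m k))"
proof -
  have "(\<lambda>A. kronecker A (1\<^sub>m k)) \<in>
      LinearCombinations.module_hom class_ring (module_mat TYPE('a) nr nc) (module_mat TYPE('a) (nr * k) (nc * k))"
    unfolding LinearCombinations.module_hom_def
    by (auto simp: module_mat_simps kronecker_def less_mult_imp_div_less algebra_simps)
  then show ?thesis
    using vectorspace_module_mat[where 'a = 'a]
    by (simp add: linear_map_def mod_hom_def mod_hom_axioms_def vectorspace_def)
qed

lemma inj_on_kronecker_one:
  assumes "k > 0"
  shows "inj_on (\<lambda>A. kronecker A (1\<^sub>m k :: 'a::field mat)) (carrier_mat nr nc)"
proof (rule inj_onI)
  fix A B :: "'a mat"
  assume A: "A \<in> carrier_mat nr nc" and B: "B \<in> carrier_mat nr nc"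
    and eq: "kronecker A (1\<^sub>m k) = kronecker B (1\<^sub>m k)"
  have entry: "kronecker C (1\<^sub>m k) $$ (i * k, j * k) = C $$ (i, j)"
    if "C \<in> carrier_mat nr nc" "i < nr" "j < nc" for C :: "'a mat" and i j
    using that assms by (simp add: kronecker_def)
  show "A = B"
    using A B eq entry by (intro eq_matI) (auto, metis)
qed

lemma kron_subspace_iff_dvd:
  assumes "0 < \<mu>" "0 < \<alpha>" "0 < \<beta>"
  shows "kron_subspace (matrix_space TYPE('a::field_char_0) \<mu> \<alpha>) (matrix_space TYPE('a) \<mu> \<beta>)
    \<longleftrightarrow> \<alpha> dvd \<beta>"
proof
  assume "kron_subspace (matrix_space TYPE('a) \<mu> \<alpha>) (matrix_space TYPE('a) \<mu> \<beta>)"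
  then obtain k where lin: "linear_map class_ring (matrix_space TYPE('a) \<mu> \<alpha>)
      (matrix_space TYPE('a) \<mu> \<beta>) (\<lambda>A. kronecker A (1\<^sub>m k))"
    unfolding kron_subspace_def by blast
  let ?Z = "0\<^sub>m (\<alpha> * ratio_num \<mu>) (\<alpha> * ratio_den \<mu>) :: 'a mat"
  have "kronecker ?Z (1\<^sub>m k) \<in> carrier_mat (\<beta> * ratio_num \<mu>) (\<beta> * ratio_den \<mu>)"
    using lin unfolding linear_map_def mod_hom_def mod_hom_axioms_def
      LinearCombinations.module_hom_def
    by (auto simp: matrix_space_def module_mat_simps)
  from carrier_matD(1)[OF this] have "\<alpha> * ratio_num \<mu> * k = \<beta> * ratio_num \<mu>"
    by (simp add: kronecker_def)
  then have "ratio_num \<mu> * (\<alpha> * k) = ratio_num \<mu> * \<beta>" by (simp add: ac_simps)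
  then have "\<beta> = \<alpha> * k"
    using ratio_num_den(1)[OF assms(1)] by simp
  then show "\<alpha> dvd \<beta>" by simp
next
  assume "\<alpha> dvd \<beta>"
  then obtain k where k: "\<beta> = \<alpha> * k" by blast
  then have "k > 0" using assms(3) by (cases k) auto
  moreover have "linear_map class_ring (matrix_space TYPE('a) \<mu> \<alpha>) (matrix_space TYPE('a) \<mu> \<beta>)
      (\<lambda>A. kronecker A (1\<^sub>m k))"
    using linear_map_kronecker_one[where 'a = 'a, of "\<alpha> * ratio_num \<mu>" "\<alpha> * ratio_den \<mu>" k]
    by (simp add: matrix_space_def k ac_simps)
  moreover have "inj_on (\<lambda>A. kronecker A (1\<^sub>m k)) (carrier (matrix_space TYPE('a) \<mu> \<alpha>))"
    using inj_on_kronecker_one[OF \<open>k > 0\<close>] by (simp add: matrix_space_def module_mat_simps)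
  ultimately show "kron_subspace (matrix_space TYPE('a) \<mu> \<alpha>) (matrix_space TYPE('a) \<mu> \<beta>)"
    unfolding kron_subspace_def by blast
qed

end

theory Submission
  imports Defs
begin

text \<open>Comparing row counts, A \<mapsto> A \<otimes> I_k can map index \<alpha> into index
  \<beta> only if \<beta> = \<alpha> k; conversely, for such k > 0 this map is linear and injective.
  So \<open>kron_subspace\<close> between spaces of positive index is divisibility of the indices,
  and the collection is a copy of the positive integers ordered by divisibility, where suprema are
  lcms and infima are gcds. \<open>le_matrix_space_order_iff_dvd\<close> is the dictionary;
  \<open>least_Upper_matrix_space_lcm\<close> and \<open>greatest_Lower_matrix_space_gcd\<close>
  carry the universal properties of lcm and gcd across it, giving both the existence of bounds and
  their values.\<close>

lemma carrier_matrix_space_order: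
  "carrier (matrix_space_order TYPE('a::field_char_0) \<mu>) = {matrix_space TYPE('a) \<mu> i | i. i > 0}"
  by (simp add: matrix_space_order_def)

lemma matrix_space_in_carrier:
  "0 < i \<Longrightarrow> matrix_space TYPE('a::field_char_0) \<mu> i \<in> carrier (matrix_space_order TYPE('a) \<mu>)"
  by (auto simp: matrix_space_order_def)

lemma le_matrix_space_order_iff_dvd:
  assumes "0 < \<mu>" "0 < \<alpha>" "0 < \<beta>"
  shows "matrix_space TYPE('a::field_char_0) \<mu> \<alpha> \<sqsubseteq>\<^bsub>matrix_space_order TYPE('a) \<mu>\<^esub>
      matrix_space TYPE('a) \<mu> \<beta> \<longleftrightarrow> \<alpha> dvd \<beta>"
  using kron_subspace_iff_dvd[OF assms, where 'a = 'a] by (simp add: matrix_space_order_def)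

lemma partial_order_matrix_space_order:
  assumes "0 < \<mu>"
  shows "partial_order (matrix_space_order TYPE('a::field_char_0) \<mu>)"
proof
  show "(.=\<^bsub>matrix_space_order TYPE('a) \<mu>\<^esub>) = (=)"
    by (simp add: matrix_space_order_def)
next
  fix x y z
  assume "x \<in> carrier (matrix_space_order TYPE('a) \<mu>)"
    "y \<in> carrier (matrix_space_order TYPE('a) \<mu>)"
    "z \<in> carrier (matrix_space_order TYPE('a) \<mu>)"
    "x \<sqsubseteq>\<^bsub>matrix_space_order TYPE('a) \<mu>\<^esub> y" "y \<sqsubseteq>\<^bsub>matrix_space_order TYPE('a) \<mu>\<^esub> z"
  then show "x \<sqsubseteq>\<^bsub>matrix_space_order TYPE('a) \<mu>\<^esub> z"
    by (auto simp: carrier_matrix_space_order le_matrix_space_order_iff_dvd assms intro: dvd_trans)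
next
  fix x y
  assume "x \<in> carrier (matrix_space_order TYPE('a) \<mu>)"
    "y \<in> carrier (matrix_space_order TYPE('a) \<mu>)"
    "x \<sqsubseteq>\<^bsub>matrix_space_order TYPE('a) \<mu>\<^esub> y" "y \<sqsubseteq>\<^bsub>matrix_space_order TYPE('a) \<mu>\<^esub> x"
  \<comment> \<open>Mutual divisibility makes the two indices equal, hence also the spaces built
    from them.\<close>
  then have "x = y"
    using dvd_antisym by (fastforce simp: carrier_matrix_space_order le_matrix_space_order_iff_dvd assms)
  then show "x .=\<^bsub>matrix_space_order TYPE('a) \<mu>\<^esub> y"
    by (simp add: matrix_space_order_def)
next
  fix x
  assume "x \<in> carrier (matrix_space_order TYPE('a) \<mu>)"
  then show "x \<sqsubseteq>\<^bsub>matrix_space_order TYPE('a) \<mu>\<^esub> x"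
    by (auto simp: carrier_matrix_space_order le_matrix_space_order_iff_dvd assms)
\<comment> \<open>The remaining obligations are the equivalence laws for \<open>eq\<close> and the
  compatibility of \<open>le\<close> with it, trivial because \<open>eq\<close> is equality.\<close>
qed (simp_all add: matrix_space_order_def)

text \<open>The common multiples of \<alpha> and \<beta> are exactly the multiples of their lcm,
  which is positive and so indexes a member of the collection.\<close>

lemma least_Upper_matrix_space_lcm:
  assumes "0 < \<mu>" "0 < \<alpha>" "0 < \<beta>"
  shows "least (matrix_space_order TYPE('a::field_char_0) \<mu>) (matrix_space TYPE('a) \<mu> (lcm \<alpha> \<beta>))
    (Upper (matrix_space_order TYPE('a) \<mu>) {matrix_space TYPE('a) \<mu> \<alpha>, matrix_space TYPE('a) \<mu> \<beta>})"
    (is "least ?L ?s (Upper ?L ?A)")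
proof (rule least_UpperI)
  show sub: "?A \<subseteq> carrier ?L"
    using assms by (simp add: matrix_space_in_carrier)
  show "?s \<in> carrier ?L"
    using assms by (simp add: matrix_space_in_carrier lcm_pos_nat)
  show "x \<sqsubseteq>\<^bsub>?L\<^esub> ?s" if "x \<in> ?A" for x
    using that assms by (auto simp: le_matrix_space_order_iff_dvd lcm_pos_nat)
  fix y
  assume y: "y \<in> Upper ?L ?A"
  \<comment> \<open>\<open>Upper\<close> admits only bounds from the carrier, so y has a positive
    index i, and the claim becomes: \<alpha> and \<beta> divide i, hence so does their lcm.\<close>
  then obtain i where i: "0 < i" "y = matrix_space TYPE('a) \<mu> i"
    by (auto simp: Upper_def carrier_matrix_space_order)
  moreover have "matrix_space TYPE('a) \<mu> \<alpha> \<sqsubseteq>\<^bsub>?L\<^esub> y" "matrix_space TYPE('a) \<mu> \<beta> \<sqsubseteq>\<^bsub>?L\<^esub> y"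
    using Upper_memD[OF y _ sub] by auto
  ultimately show "?s \<sqsubseteq>\<^bsub>?L\<^esub> y"
    using assms by (simp add: le_matrix_space_order_iff_dvd lcm_pos_nat)
qed

text \<open>Dual to the lcm case: the common divisors of \<alpha> and \<beta> are exactly the
  divisors of their gcd.\<close>

lemma greatest_Lower_matrix_space_gcd:
  assumes "0 < \<mu>" "0 < \<alpha>" "0 < \<beta>"
  shows "greatest (matrix_space_order TYPE('a::field_char_0) \<mu>) (matrix_space TYPE('a) \<mu> (gcd \<alpha> \<beta>))
    (Lower (matrix_space_order TYPE('a) \<mu>) {matrix_space TYPE('a) \<mu> \<alpha>, matrix_space TYPE('a) \<mu> \<beta>})"
    (is "greatest ?L ?s (Lower ?L ?A)")
proof (rule greatest_LowerI)
  show sub: "?A \<subseteq> carrier ?L"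
    using assms by (simp add: matrix_space_in_carrier)
  show "?s \<in> carrier ?L"
    using assms by (simp add: matrix_space_in_carrier)
  show "?s \<sqsubseteq>\<^bsub>?L\<^esub> x" if "x \<in> ?A" for x
    using that assms by (auto simp: le_matrix_space_order_iff_dvd)
  fix y
  assume y: "y \<in> Lower ?L ?A"
  then obtain i where i: "0 < i" "y = matrix_space TYPE('a) \<mu> i"
    by (auto simp: Lower_def carrier_matrix_space_order)
  moreover have "y \<sqsubseteq>\<^bsub>?L\<^esub> matrix_space TYPE('a) \<mu> \<alpha>" "y \<sqsubseteq>\<^bsub>?L\<^esub> matrix_space TYPE('a) \<mu> \<beta>"
    using Lower_memD[OF y _ sub] by auto
  ultimately show "y \<sqsubseteq>\<^bsub>?L\<^esub> ?s"
    using assms by (simp add: le_matrix_space_order_iff_dvd)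
qed

lemma lattice_matrix_space_order:
  assumes "0 < \<mu>"
  shows "lattice (matrix_space_order TYPE('a::field_char_0) \<mu>)"
proof -
  interpret partial_order "matrix_space_order TYPE('a) \<mu>"
    using assms by (rule partial_order_matrix_space_order)
  show ?thesis
  \<comment> \<open>Given the partial order, only the existence of bounds for pairs is left; the lcm
    and gcd of the indices are the witnesses.\<close>
  proof
    fix x y
    assume "x \<in> carrier (matrix_space_order TYPE('a) \<mu>)"
      "y \<in> carrier (matrix_space_order TYPE('a) \<mu>)"
    then obtain \<alpha> \<beta> where "0 < \<alpha>" "x = matrix_space TYPE('a) \<mu> \<alpha>" "0 < \<beta>" "y = matrix_space TYPE('a) \<mu> \<beta>"
      by (auto simp: carrier_matrix_space_order)
    then show "\<exists>s. least (matrix_space_order TYPE('a) \<mu>) s (Upper (matrix_space_order TYPE('a) \<mu>) {x, y})"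
      and "\<exists>s. greatest (matrix_space_order TYPE('a) \<mu>) s (Lower (matrix_space_order TYPE('a) \<mu>) {x, y})"
      using least_Upper_matrix_space_lcm greatest_Lower_matrix_space_gcd assms by blast+
  qed
qed

theorem proposition33:
  fixes \<mu> :: rat
  assumes "0 < \<mu>"
  shows "lattice (matrix_space_order TYPE('a::field_char_0) \<mu>) \<and>
    (\<forall>\<alpha> \<beta>. 0 < \<alpha> \<longrightarrow> 0 < \<beta> \<longrightarrow>
      matrix_space TYPE('a) \<mu> \<alpha> \<squnion>\<^bsub>matrix_space_order TYPE('a) \<mu>\<^esub> matrix_space TYPE('a) \<mu> \<beta>
        = matrix_space TYPE('a) \<mu> (lcm \<alpha> \<beta>) \<and>
      matrix_space TYPE('a) \<mu> \<alpha> \<sqinter>\<^bsub>matrix_space_order TYPE('a) \<mu>\<^esub> matrix_space TYPE('a) \<mu> \<beta>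
        = matrix_space TYPE('a) \<mu> (gcd \<alpha> \<beta>))"
proof (intro conjI allI impI)
  show "lattice (matrix_space_order TYPE('a) \<mu>)"
    using assms by (rule lattice_matrix_space_order)
  then interpret lattice "matrix_space_order TYPE('a) \<mu>" .
  fix \<alpha> \<beta> :: nat
  assume pos: "0 < \<alpha>" "0 < \<beta>"
  show "matrix_space TYPE('a) \<mu> \<alpha> \<squnion>\<^bsub>matrix_space_order TYPE('a) \<mu>\<^esub> matrix_space TYPE('a) \<mu> \<beta>
      = matrix_space TYPE('a) \<mu> (lcm \<alpha> \<beta>)"
    \<comment> \<open>The join is defined by choice among least upper bounds, so
      \<open>joinI\<close> asks for the equation for every such bound; uniqueness identifies each
      with the lcm space. The meet is treated dually.\<close>
    by (rule joinI) (use pos assms in \<open>auto intro: least_unique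
        least_Upper_matrix_space_lcm matrix_space_in_carrier\<close>)
  show "matrix_space TYPE('a) \<mu> \<alpha> \<sqinter>\<^bsub>matrix_space_order TYPE('a) \<mu>\<^esub> matrix_space TYPE('a) \<mu> \<beta>
      = matrix_space TYPE('a) \<mu> (gcd \<alpha> \<beta>)"
    by (rule meetI) (use pos assms in \<open>auto intro: greatest_unique
        greatest_Lower_matrix_space_gcd matrix_space_in_carrier\<close>)
qed

end
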